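(* If the target committee size is $k$, every voter approves exactly $k$ candidates (i.e. $|A_i|=k$ for all $i\in N$), and ties are broken in favor of sets that provide JR, then Minimax Approval Voting ($\mathit{MAV}$) satisfies JR; that is, for every ballot profile $\vec{A}=(A_1,\dots,A_n)$ with $|A_i|=k$ for all $i\in N$, the committee output by $\mathit{MAV}$ with such a tie-breaking rule on $(\vec{A},k)$ provides justified representation for $(\vec{A},k)$.
   Context: Setting. $N=\{1,\dots,n\}$ ($n\ge 1$) is a set of voters, $C$ is a finite set of candidates. Each voter $i\in N$ submits an approval ballot $A_i\subseteq C$; the list $\vec{A}=(A_1,\dots,A_n)$ is the ballot profile. An approval-based multi-winner rule takes $(N,C,\vec{A},k)$ with $1\le k\le|C|$ and returns a committee $W\subseteq C$ with $|W|=k$. Justified representation (JR). A set $W\subseteq C$ with $|W|=k$ provides justified representation for $(\vec{A},k)$ if there is no set of voters $N^*\subseteq N$ with $|N^*|\ge \frac{n}{k}$ such that $\bigcap_{i\in N^*}A_i\neq\emptyset$ and $A_i\cap W=\emptyset$ for all $i\in N^*$. $\mathit{MAV}$: let $d(Q,T)=|Q\setminus T|+|T\setminus Q|$ be the Hamming distance. The $\mathit{MAV}$-score of $W\subseteq C$ is $\max(d(W,A_1),\dots,d(W,A_n))$, and $\mathit{MAV}$ outputs a size-$k$ set with the lowest $\mathit{MAV}$-score. Ties are broken in favor of sets that provide JR if, whenever some size-$k$ set with the lowest $\mathit{MAV}$-score provides JR, the selected set provides JR. *)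

theory Defs
  imports Complex_Main
begin

text \<open>
  Voters are \<open>{1..n}\<close>; a ballot profile is a function on voter indices, of which only the
  values on \<open>{1..n}\<close> are relevant.
\<close>

type_synonym 'c profile = "nat \<Rightarrow> 'c set"

type_synonym 'c multiwinner_rule = "nat \<Rightarrow> 'c set \<Rightarrow> 'c profile \<Rightarrow> nat \<Rightarrow> 'c set"

definition election :: "nat \<Rightarrow> 'c set \<Rightarrow> 'c profile \<Rightarrow> nat \<Rightarrow> bool" where
  "election n C A k \<longleftrightarrow>
     1 \<le> n \<and> finite C \<and> (\<forall>i\<in>{1..n}. A i \<subseteq> C) \<and> 1 \<le> k \<and> k \<le> card C"

definition committees :: "'c set \<Rightarrow> nat \<Rightarrow> 'c set set" where
  "committees C k = {W. W \<subseteq> C \<and> card W = k}"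

text \<open>
  For \<open>n, k \<ge> 1\<close> the bound \<open>n / k\<close> is positive, so the group \<open>S\<close> is never empty and the
  convention that an empty intersection is \<open>UNIV\<close> plays no role.
\<close>

definition provides_JR :: "nat \<Rightarrow> 'c set \<Rightarrow> 'c profile \<Rightarrow> nat \<Rightarrow> 'c set \<Rightarrow> bool" where
  "provides_JR n C A k W \<longleftrightarrow>
     W \<in> committees C k \<and>
     \<not> (\<exists>S \<subseteq> {1..n}. real (card S) \<ge> real n / real k \<and>
           (\<Inter>i\<in>S. A i) \<noteq> {} \<and> (\<forall>i\<in>S. A i \<inter> W = {}))"

definition hamming :: "'c set \<Rightarrow> 'c set \<Rightarrow> nat" where
  "hamming Q T = card (Q - T) + card (T - Q)"

definition MAV_score :: "nat \<Rightarrow> 'c profile \<Rightarrow> 'c set \<Rightarrow> nat" where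
  "MAV_score n A W = Max ((\<lambda>i. hamming W (A i)) ` {1..n})"

definition MAV_winner :: "nat \<Rightarrow> 'c set \<Rightarrow> 'c profile \<Rightarrow> nat \<Rightarrow> 'c set \<Rightarrow> bool" where
  "MAV_winner n C A k W \<longleftrightarrow> is_arg_min (MAV_score n A) (\<lambda>V. V \<in> committees C k) W"

text \<open>A rule is an instance of MAV, with some tie-breaking, if it always selects a co-winner.\<close>

definition is_MAV :: "'c multiwinner_rule \<Rightarrow> bool" where
  "is_MAV F \<longleftrightarrow> (\<forall>n C A k. election n C A k \<longrightarrow> MAV_winner n C A k (F n C A k))"

definition MAV_ties_favor_JR :: "'c multiwinner_rule \<Rightarrow> bool" where
  "MAV_ties_favor_JR F \<longleftrightarrow>
     (\<forall>n C A k. election n C A k \<longrightarrow>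
        (\<exists>W. MAV_winner n C A k W \<and> provides_JR n C A k W) \<longrightarrow>
        provides_JR n C A k (F n C A k))"

end

theory Submission
  imports Defs
begin

text \<open>
  When all ballots have size \<open>k\<close>, the largest possible MAV-score of a committee is \<open>2 k\<close>, and it
  is attained exactly by the committees disjoint from some ballot. If the minimum score is below
  \<open>2 k\<close>, the winner meets every ballot, which is stronger than JR. Otherwise every committee is a
  winner; a committee providing JR always exists (pick candidates greedily, each representing at
  least \<open>n / k\<close> new voters), so the tie-breaking selects one.
\<close>

definition unrepresented :: "nat \<Rightarrow> 'c profile \<Rightarrow> 'c set \<Rightarrow> nat set" where
  "unrepresented n A W = {i \<in> {1..n}. A i \<inter> W = {}}"

lemma finite_unrepresented [simp]: "finite (unrepresented n A W)"
  by (simp add: unrepresented_def)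

lemma unrepresented_antimono: "V \<subseteq> W \<Longrightarrow> unrepresented n A W \<subseteq> unrepresented n A V"
  by (auto simp: unrepresented_def)

text \<open>The quota \<open>card S \<ge> n / k\<close> is multiplied out by \<open>k\<close>, which
  keeps the counting below in \<open>nat\<close>.\<close>

definition cohesive :: "nat \<Rightarrow> 'c profile \<Rightarrow> nat \<Rightarrow> nat set \<Rightarrow> bool" where
  "cohesive n A k S \<longleftrightarrow> n \<le> k * card S \<and> (\<Inter>i\<in>S. A i) \<noteq> {}"

lemma provides_JR_iff:
  assumes "1 \<le> k"
  shows "provides_JR n C A k W \<longleftrightarrow>
    W \<in> committees C k \<and> (\<forall>S \<subseteq> unrepresented n A W. \<not> cohesive n A k S)"
proof -
  have "real (card S) \<ge> real n / real k \<longleftrightarrow> n \<le> k * card S" for S :: "nat set"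
    using assms by (simp add: pos_divide_le_eq mult.commute flip: of_nat_mult)
  moreover have "S \<subseteq> unrepresented n A W \<longleftrightarrow> S \<subseteq> {1..n} \<and> (\<forall>i\<in>S. A i \<inter> W = {})" for S
    by (auto simp: unrepresented_def)
  ultimately show ?thesis
    unfolding provides_JR_def cohesive_def by metis
qed

text \<open>Invariant of the greedy procedure after \<open>j\<close> rounds: either it has stopped
  early, for lack of a cohesive group, or each round has newly represented at least
  \<open>n / k\<close> voters. Early stopping is the reason for \<open>card W \<le> j\<close>
  instead of equality.\<close>

lemma greedy_representation:
  assumes "election n C A k" "j \<le> k"
  shows "\<exists>W \<subseteq> C. card W \<le> j \<and>
    ((\<forall>S \<subseteq> unrepresented n A W. \<not> cohesive n A k S) \<or>
     k * card (unrepresented n A W) \<le> (k - j) * n)"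
  using \<open>j \<le> k\<close>
proof (induction j)
  case 0
  have "unrepresented n A {} = {1..n}"
    by (auto simp: unrepresented_def)
  then show ?case
    by (intro exI[of _ "{}"]) simp
next
  case (Suc j)
  then obtain W where W: "W \<subseteq> C" "card W \<le> j"
    "(\<forall>S \<subseteq> unrepresented n A W. \<not> cohesive n A k S) \<or>
     k * card (unrepresented n A W) \<le> (k - j) * n"
    by auto
  show ?case
  proof (cases "\<forall>S \<subseteq> unrepresented n A W. \<not> cohesive n A k S")
    case True
    with W show ?thesis
      by (intro exI[of _ W]) simp
  next
    case False
    then obtain S c where S: "S \<subseteq> unrepresented n A W" "n \<le> k * card S" "\<forall>i\<in>S. c \<in> A i"
      by (auto simp: cohesive_def)
    \<comment> \<open>As \<open>n \<ge> 1\<close>, the quota excludes the empty group; any member of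
      \<open>S\<close> then approves \<open>c\<close>, which puts \<open>c\<close> in
      \<open>C\<close>.\<close>
    have "S \<noteq> {}"
      using S(2) assms(1) by (auto simp: election_def)
    with S have "c \<in> C"
      using assms(1) unfolding election_def unrepresented_def by blast
    have "unrepresented n A (insert c W) \<subseteq> unrepresented n A W - S"
      using S(3) by (auto simp: unrepresented_def)
    then have "card (unrepresented n A (insert c W)) \<le> card (unrepresented n A W) - card S"
      using S(1) by (metis card_Diff_subset card_mono finite_Diff finite_subset finite_unrepresented)
    then have "k * card (unrepresented n A (insert c W))
        \<le> k * card (unrepresented n A W) - k * card S"
      by (metis diff_mult_distrib2 mult_le_mono2)
    \<comment> \<open>Truncated subtraction is monotone in the minuend and antitone in the
      subtrahend: the induction hypothesis bounds the former, the quota for \<open>S\<close> the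
      latter.\<close>
    also have "\<dots> \<le> (k - j) * n - n"
      using W(3) False S(2) by (meson diff_le_mono diff_le_mono2 order_trans)
    also have "\<dots> = (k - Suc j) * n"
      by (simp add: diff_mult_distrib)
    finally show ?thesis
      using W(1,2) \<open>c \<in> C\<close> finite_subset[OF W(1)] assms(1)
      by (intro exI[of _ "insert c W"]) (auto simp: card_insert_if election_def)
  qed
qed

lemma committee_superset:
  assumes "finite C" "W \<subseteq> C" "card W \<le> k" "k \<le> card C"
  obtains V where "V \<in> committees C k" "W \<subseteq> V"
  using exists_subset_between[OF assms(3,4,2,1)] by (auto simp: committees_def)

lemma JR_committee_exists:
  assumes "election n C A k"
  obtains W where "provides_JR n C A k W"
proof -
  from assms have k: "1 \<le> k" and n: "1 \<le> n" and C: "finite C" "k \<le> card C"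
    by (auto simp: election_def)
  obtain W where W: "W \<subseteq> C" "card W \<le> k"
    "(\<forall>S \<subseteq> unrepresented n A W. \<not> cohesive n A k S) \<or> k * card (unrepresented n A W) = 0"
    using greedy_representation[OF assms order_refl] by auto
  \<comment> \<open>In the second alternative nobody is unrepresented, so \<open>S\<close> is empty
    and misses the quota.\<close>
  have "\<not> cohesive n A k S" if "S \<subseteq> unrepresented n A W" for S
    using W(3) that k n by (auto simp: cohesive_def)
  \<comment> \<open>Padding \<open>W\<close> to size \<open>k\<close> can only shrink the set of
    unrepresented voters, so no cohesive group reappears.\<close>
  moreover obtain V where "V \<in> committees C k" "W \<subseteq> V"
    using committee_superset[OF C(1) W(1,2) C(2)] .
  ultimately have "provides_JR n C A k V"
    using unrepresented_antimono[of W V n A] unfolding provides_JR_iff[OF k] by blast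
  then show thesis ..
qed

text \<open>The sum of the two sizes exceeds the distance by
  \<open>2 * card (Q \<inter> T)\<close>.\<close>

lemma hamming_eq_card_add_iff_disjoint:
  assumes "finite Q" "finite T"
  shows "hamming Q T = card Q + card T \<longleftrightarrow> Q \<inter> T = {}"
proof -
  have "card (Q \<inter> T) + card (Q - T) = card Q" "card (Q \<inter> T) + card (T - Q) = card T"
    using assms card_Int_Diff[of Q T] card_Int_Diff[of T Q] by (simp_all add: Int_commute)
  moreover have "card (Q \<inter> T) = 0 \<longleftrightarrow> Q \<inter> T = {}"
    using assms by simp
  ultimately show ?thesis
    unfolding hamming_def by linarith
qed

lemma hamming_le_card_add:
  assumes "finite Q" "finite T"
  shows "hamming Q T \<le> card Q + card T"
  unfolding hamming_def using assms by (intro add_mono card_mono) auto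

lemma provides_JR_if_all_represented:
  assumes "election n C A k" "W \<in> committees C k" "\<forall>i\<in>{1..n}. A i \<inter> W \<noteq> {}"
  shows "provides_JR n C A k W"
proof -
  have "unrepresented n A W = {}" and "1 \<le> k" and "1 \<le> n"
    using assms by (auto simp: unrepresented_def election_def)
  with assms(2) show ?thesis
    by (simp add: provides_JR_iff cohesive_def)
qed

theorem theorem5:
  fixes F :: "'c multiwinner_rule"
    and n k :: nat
    and C :: "'c set"
    and A :: "'c profile"
  assumes "is_MAV F"
    and "MAV_ties_favor_JR F"
    and "election n C A k"
    and "\<forall>i\<in>{1..n}. card (A i) = k"
  shows "provides_JR n C A k (F n C A k)"
proof -
  let ?W = "F n C A k"
  have n: "1 \<le> n" and fin: "\<And>V. V \<in> committees C k \<Longrightarrow> finite V \<and> card V = k"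
    "\<And>i. i \<in> {1..n} \<Longrightarrow> finite (A i) \<and> card (A i) = k"
    using assms(3,4) finite_subset[of _ C] unfolding election_def committees_def by blast+
  have score_le: "MAV_score n A V \<le> 2 * k" if "V \<in> committees C k" for V
  proof -
    have "hamming V (A i) \<le> 2 * k" if "i \<in> {1..n}" for i
      using hamming_le_card_add[of V "A i"] fin(1)[OF \<open>V \<in> committees C k\<close>] fin(2)[OF that] by simp
    then show ?thesis
      using n by (auto simp: MAV_score_def)
  qed
  have winner: "MAV_winner n C A k ?W"
    using assms(1,3) by (auto simp: is_MAV_def)
  then have W: "?W \<in> committees C k"
    by (auto simp: MAV_winner_def is_arg_min_def)
  show ?thesis
  proof (cases "\<forall>i\<in>{1..n}. A i \<inter> ?W \<noteq> {}")
    case True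
    then show ?thesis
      using provides_JR_if_all_represented[OF assms(3) W] by simp
  next
    case False
    then obtain i where i: "i \<in> {1..n}" "?W \<inter> A i = {}"
      by blast
    \<comment> \<open>One unrepresented voter already pushes the score of the winner up to the
      maximum \<open>2 * k\<close>.\<close>
    have "2 * k = hamming ?W (A i)"
      using hamming_eq_card_add_iff_disjoint[of ?W "A i"] fin(1)[OF W] fin(2)[OF i(1)] i(2) by simp
    also have "\<dots> \<le> MAV_score n A ?W"
      unfolding MAV_score_def using i(1) by (intro Max_ge) auto
    finally have max_score: "2 * k \<le> MAV_score n A ?W" .
    obtain V where V: "provides_JR n C A k V"
      using JR_committee_exists[OF assms(3)] .
    then have "V \<in> committees C k"
      by (simp add: provides_JR_def)
    \<comment> \<open>The minimum score equals the upper bound \<open>2 * k\<close>, so all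
      committees tie, including \<open>V\<close>.\<close>
    then have "MAV_winner n C A k V"
      using winner max_score score_le[of V]
      unfolding MAV_winner_def is_arg_min_linorder by (meson order_trans)
    with V show ?thesis
      using assms(2,3) unfolding MAV_ties_favor_JR_def by blast
  qed
qed

end
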